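(* Let $n\geq 2$ be an integer, let $c\in\mathbb{R}$, and let $f$ be a real-valued function defined in a neighborhood of $c$. Suppose that (i) $f$ is $n-1$ times Peano differentiable at $c$, and (ii) for every integer $k$ with $-(n-2)\leq k\leq 0$, the limit $$\lim_{h\rightarrow 0}\frac 1{h^{n}}\sum_{j=0}^{n}(-1)^{n-j}\binom{n}{j}f(c+(j-k)h)$$ exists (as a finite real number). Then $f$ is $n$ times Peano differentiable at $c$.
   Context: For an integer $m\ge 1$, a real-valued function $f$ defined in a neighborhood of $c$ is said to be $m$ times Peano differentiable at $c$ if there is a polynomial $p$ with real coefficients, of degree at most $m$ and with $p(c)=f(c)$, such that $f(c+h)-p(c+h)=o(h^m)$ as $h\rightarrow 0$. All limits as $h\to 0$ are two-sided. *)

theory Defs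
  imports
    "HOL-Analysis.Analysis"
    "HOL-Library.Landau_Symbols"
    "HOL-Computational_Algebra.Polynomial"
begin

text \<open>
  A function defined near \<open>c\<close> is represented by an arbitrary total extension: the condition only
  depends on the values of \<open>f\<close> in a neighbourhood of \<open>c\<close>. The filter \<open>at 0\<close> is the two-sided
  punctured one. The definition is intended for \<open>m \<ge> 1\<close>.
\<close>
definition peano_differentiable :: "nat \<Rightarrow> (real \<Rightarrow> real) \<Rightarrow> real \<Rightarrow> bool" where
  "peano_differentiable m f c \<longleftrightarrow>
     (\<exists>p :: real poly. degree p \<le> m \<and> poly p c = f c \<and>
        (\<lambda>h. f (c + h) - poly p (c + h)) \<in> o[at 0](\<lambda>h. h ^ m))"

end

theory Submission
  imports Defs
begin

text \<open>
  With \<open>p\<close> from (i), let \<open>g h = f (c + h) - p (c + h)\<close>, so that \<open>g h = o(h ^ (n - 1))\<close>, and let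
  \<open>P\<^sub>h = (\<Sum>k<n. a\<^sub>k(h) x ^ k)\<close> interpolate \<open>x \<mapsto> g (x h)\<close> at \<open>x = 0, \<dots>, n - 1\<close>. The
  \<open>n\<close>-th differences kill \<open>P\<^sub>h\<close>, so (ii) gives \<open>g (x h) - P\<^sub>h(x) = L\<^sub>x h ^ n + o(h ^ n)\<close> also for
  \<open>x = n, \<dots>, 2 n - 2\<close>. Hence, up to such terms, \<open>P\<^bsub>2h\<^esub>(x)\<close> and \<open>P\<^sub>h(2 x)\<close> agree at the \<open>n\<close>
  points \<open>x = 0, \<dots>, n - 1\<close>, and comparing coefficients
  \<open>a\<^sub>k(2 h) - 2 ^ k a\<^sub>k(h) = C\<^sub>k h ^ n + o(h ^ n)\<close>. As \<open>k < n\<close> and \<open>a\<^sub>k(h) = o(h ^ (n - 1))\<close>,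
  telescoping along \<open>h, h / 2, h / 4, \<dots>\<close> yields \<open>a\<^sub>k(h) = A\<^sub>k h ^ n + o(h ^ n)\<close>, and
  \<open>g h = (\<Sum>k<n. a\<^sub>k(h))\<close>.
\<close>

section \<open>Finite differences\<close>

definition fdiff :: "nat \<Rightarrow> (nat \<Rightarrow> real) \<Rightarrow> real" where
  "fdiff n u = (\<Sum>j=0..n. (-1) ^ (n - j) * real (n choose j) * u j)"

text \<open>Pascal's rule splits the sum into the \<open>n\<close>-th difference of the shifted
  sequence and minus that of \<open>u\<close>.\<close>

lemma fdiff_Suc: "fdiff (Suc n) u = fdiff n (\<lambda>j. u (Suc j) - u j)"
proof -
  have "fdiff (Suc n) u
      = (\<Sum>j\<le>Suc n. (-1) ^ (Suc n - j) * real (Suc n choose j) * u j)"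
    by (simp add: fdiff_def atLeast0AtMost)
  also have "\<dots> = (-1) ^ Suc n * u 0
      + (\<Sum>j\<le>n. (-1) ^ (n - j) * (real (n choose j) + real (n choose Suc j)) * u (Suc j))"
    by (simp add: sum.atMost_Suc_shift del: sum.atMost_Suc)
  also have "\<dots> = (\<Sum>j\<le>n. (-1) ^ (n - j) * real (n choose j) * u (Suc j))
      + ((-1) ^ Suc n * u 0 + (\<Sum>j\<le>n. (-1) ^ (n - j) * real (n choose Suc j) * u (Suc j)))"
    by (simp add: algebra_simps sum.distrib)
  also have "(-1) ^ Suc n * u 0 + (\<Sum>j\<le>n. (-1) ^ (n - j) * real (n choose Suc j) * u (Suc j))
      = (\<Sum>j\<le>Suc n. (-1) ^ (Suc n - j) * real (n choose j) * u j)"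
    by (simp add: sum.atMost_Suc_shift del: sum.atMost_Suc)
  \<comment> \<open>The top term vanishes, since \<open>n choose Suc n\<close> is 0.\<close>
  also have "\<dots> = - (\<Sum>j\<le>n. (-1) ^ (n - j) * real (n choose j) * u j)"
    by (simp add: Suc_diff_le sum_negf)
  finally show ?thesis
    by (simp add: fdiff_def atLeast0AtMost right_diff_distrib sum_subtractf)
qed

lemma fdiff_diff: "fdiff n (\<lambda>j. u j - v j) = fdiff n u - fdiff n v"
  by (simp add: fdiff_def right_diff_distrib sum_subtractf)

text \<open>Each differencing lowers the degree: p(x + 1) and p(x) share degree and leading
  coefficient.\<close>

lemma fdiff_poly_eq_0:
  fixes p :: "real poly"
  assumes "degree p < n"
  shows "fdiff n (\<lambda>j. poly p (real j)) = 0"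
  using assms
proof (induction n arbitrary: p)
  case 0
  then show ?case by simp
next
  case (Suc n)
  define q where "q = p \<circ>\<^sub>p [:1, 1:] - p"
  have q: "poly q (real j) = poly p (1 + real j) - poly p (real j)" for j
    by (simp add: q_def poly_pcompose)
  show ?case
  \<comment> \<open>For a constant the degree cannot drop below 0, but the first difference is
    already zero.\<close>
  proof (cases "degree p = 0")
    case True
    then obtain a where "p = [:a:]" by (rule degree_eq_zeroE)
    then show ?thesis by (simp add: fdiff_Suc) (simp add: fdiff_def)
  next
    case False
    have "degree (p \<circ>\<^sub>p [:1, 1:]) = degree p"
      by (simp add: degree_pcompose)
    moreover have "lead_coeff (p \<circ>\<^sub>p [:1, 1:]) = lead_coeff p"
      by (subst lead_coeff_comp) auto
    ultimately have "degree q \<le> degree p" "coeff q (degree p) = 0"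
      by (auto simp: q_def intro!: degree_diff_le)
    with False have "degree q < degree p"
      by (metis degree_0 gr0I leading_coeff_0_iff le_neq_implies_less)
    with Suc show ?thesis
      by (simp add: fdiff_Suc flip: q)
  qed
qed

section \<open>Lagrange interpolation at 0, ..., n - 1\<close>

definition lagrange :: "nat \<Rightarrow> nat \<Rightarrow> real poly" where
  "lagrange n i = (\<Prod>j\<in>{..<n} - {i}. smult (1 / (real i - real j)) [:- real j, 1:])"

lemma poly_lagrange:
  assumes "i < n" "j < n"
  shows "poly (lagrange n i) (real j) = (if j = i then 1 else 0)"
proof (cases "j = i")
  case True
  then show ?thesis
    by (simp add: lagrange_def poly_prod) (rule prod.neutral, auto simp flip: diff_divide_distrib)
next
  case False
  with assms show ?thesis
    by (auto simp: lagrange_def poly_prod)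
qed

lemma degree_lagrange:
  assumes "i < n"
  shows "degree (lagrange n i) < n"
proof -
  have "degree (lagrange n i) \<le> (\<Sum>j\<in>{..<n} - {i}. 1)"
    unfolding lagrange_def
    by (rule order.trans[OF degree_prod_sum_le]) (auto intro!: sum_mono)
  with assms show ?thesis by simp
qed

definition interp :: "nat \<Rightarrow> (nat \<Rightarrow> real) \<Rightarrow> real poly" where
  "interp n u = (\<Sum>i<n. smult (u i) (lagrange n i))"

lemma coeff_interp: "coeff (interp n u) k = (\<Sum>i<n. u i * coeff (lagrange n i) k)"
  by (simp add: interp_def coeff_sum)

lemma poly_interp:
  assumes "j < n"
  shows "poly (interp n u) (real j) = u j"
proof -
  have "poly (interp n u) (real j) = (\<Sum>i<n. if i = j then u i else 0)"
    unfolding interp_def poly_sum using assms by (intro sum.cong) (auto simp: poly_lagrange)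
  with assms show ?thesis by simp
qed

lemma degree_interp:
  assumes "0 < n"
  shows "degree (interp n u) < n"
  unfolding interp_def
  using assms by (intro degree_sum_less) (auto intro: le_less_trans[OF degree_smult_le] degree_lagrange)

text \<open>Two polynomials of degree below \<open>n\<close> that agree at \<open>n\<close> points
  are equal. With \<open>coeff_interp\<close> this makes each coefficient a fixed linear combination
  of the values at the nodes.\<close>

lemma interp_poly:
  assumes "degree p < n"
  shows "interp n (\<lambda>j. poly p (real j)) = p"
proof (rule poly_eqI_degree[where A = "real ` {..<n}"])
  have "card (real ` {..<n}) = n" by (simp add: card_image)
  then show "degree p < card (real ` {..<n})"
    and "degree (interp n (\<lambda>j. poly p (real j))) < card (real ` {..<n})"
    using assms degree_interp[of n] by auto
qed (auto simp: poly_interp)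

section \<open>Expansions to order n at 0, and doubling\<close>

text \<open>This encodes u(h) = L h^n + o(h^n). L may be 0, so such functions form a vector
  space.\<close>

definition has_order :: "nat \<Rightarrow> (real \<Rightarrow> real) \<Rightarrow> bool" where
  "has_order n u \<longleftrightarrow> (\<exists>L. ((\<lambda>h. u h / h ^ n) \<longlongrightarrow> L) (at 0))"

lemma has_order_0: "has_order n (\<lambda>h. 0)"
  by (auto simp: has_order_def)

lemma has_order_diff: "has_order n u \<Longrightarrow> has_order n v \<Longrightarrow> has_order n (\<lambda>h. u h - v h)"
  unfolding has_order_def diff_divide_distrib using tendsto_diff by blast

lemma has_order_cmult: "has_order n u \<Longrightarrow> has_order n (\<lambda>h. a * u h)"
  unfolding has_order_def times_divide_eq_right[symmetric] using tendsto_mult_left by blast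

lemma has_order_sum: "(\<And>i. i \<in> I \<Longrightarrow> has_order n (u i)) \<Longrightarrow> has_order n (\<lambda>h. \<Sum>i\<in>I. u i h)"
proof -
  assume "\<And>i. i \<in> I \<Longrightarrow> has_order n (u i)"
  then obtain L where "\<And>i. i \<in> I \<Longrightarrow> ((\<lambda>h. u i h / h ^ n) \<longlongrightarrow> L i) (at 0)"
    unfolding has_order_def by metis
  then have "((\<lambda>h. \<Sum>i\<in>I. u i h / h ^ n) \<longlongrightarrow> (\<Sum>i\<in>I. L i)) (at 0)"
    by (rule tendsto_sum)
  then show ?thesis
    by (auto simp: has_order_def sum_divide_distrib)
qed

text \<open>Since \<open>\<phi> (h / 2 ^ N)\<close> tends to 0, \<open>\<phi> h\<close> is the sum
  of the increments along h, h/2, h/4, ..., which a geometric series dominates.\<close>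

lemma tendsto_0_of_doubling:
  fixes \<phi> :: "real \<Rightarrow> real"
  assumes "0 < m" and lim: "(\<phi> \<longlongrightarrow> 0) (at 0)"
    and dbl: "((\<lambda>h. (\<phi> (2 * h) - \<phi> h) / h ^ m) \<longlongrightarrow> 0) (at 0)"
  shows "((\<lambda>h. \<phi> h / h ^ m) \<longlongrightarrow> 0) (at 0)"
proof (rule LIM_I)
  fix r :: real assume "0 < r"
  \<comment> \<open>Halving leaves room for strictness: the limit over \<open>N\<close> only gives a
    bound with \<le>.\<close>
  define e where "e = r / 2"
  with \<open>0 < r\<close> have "0 < e" "e < r" by auto
  from LIM_D[OF dbl \<open>0 < e\<close>] obtain d where "0 < d"
    and d: "\<And>h. h \<noteq> 0 \<Longrightarrow> \<bar>h\<bar> < d \<Longrightarrow> \<bar>(\<phi> (2 * h) - \<phi> h) / h ^ m\<bar> < e"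
    by auto
  have step: "\<bar>\<phi> (2 * h) - \<phi> h\<bar> \<le> e * \<bar>h\<bar> ^ m" if "h \<noteq> 0" "\<bar>h\<bar> < d" for h
    using d[OF that] that by (simp add: abs_divide power_abs divide_less_eq)
  have bound: "\<bar>\<phi> h\<bar> \<le> e * \<bar>h\<bar> ^ m" if h: "h \<noteq> 0" "\<bar>h\<bar> < d" for h
  proof -
    \<comment> \<open>The last factor is the partial sum 1/2 + 1/4 + ... + 1/2^N.\<close>
    have iter: "\<bar>\<phi> h\<bar> \<le> \<bar>\<phi> (h / 2 ^ N)\<bar> + e * \<bar>h\<bar> ^ m * (1 - 1 / 2 ^ N)" for N
    proof (induction N)
      case 0
      then show ?case by simp
    next
      case (Suc N)
      let ?k = "h / 2 ^ Suc N"
      have "\<bar>?k\<bar> \<le> \<bar>h\<bar>"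
        by (simp add: abs_divide divide_le_eq mult_le_cancel_left1 del: power_Suc)
      with h have "\<bar>\<phi> (2 * ?k) - \<phi> ?k\<bar> \<le> e * \<bar>?k\<bar> ^ m"
        by (intro step) auto
      also have "\<bar>?k\<bar> ^ m = \<bar>h\<bar> ^ m * (1 / 2 ^ Suc N) ^ m"
        by (simp add: abs_divide power_divide)
      \<comment> \<open>Here \<open>m\<close> \<ge> 1 makes the increments at least as small as the
        geometric ones.\<close>
      also have "(1 / 2 ^ Suc N :: real) ^ m \<le> (1 / 2 ^ Suc N) ^ 1"
        using \<open>0 < m\<close> by (intro power_decreasing) (auto simp del: power_Suc)
      finally have "\<bar>\<phi> (h / 2 ^ N) - \<phi> ?k\<bar> \<le> e * \<bar>h\<bar> ^ m * (1 / 2 ^ Suc N)"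
        using \<open>0 < e\<close> by (simp add: mult_left_mono mult.assoc)
      from order.trans[OF abs_triangle_ineq2 this]
      have "\<bar>\<phi> (h / 2 ^ N)\<bar> \<le> e * \<bar>h\<bar> ^ m * (1 / 2 ^ Suc N) + \<bar>\<phi> ?k\<bar>"
        by (simp only: diff_le_eq)
      with Suc have "\<bar>\<phi> h\<bar>
          \<le> (e * \<bar>h\<bar> ^ m * (1 / 2 ^ Suc N) + \<bar>\<phi> ?k\<bar>) + e * \<bar>h\<bar> ^ m * (1 - 1 / 2 ^ N)"
        by (rule order.trans[OF _ add_right_mono])
      also have "\<dots> = \<bar>\<phi> ?k\<bar> + e * \<bar>h\<bar> ^ m * (1 - 1 / 2 ^ Suc N)"
        by (simp add: right_diff_distrib)
      finally show ?case .
    qed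
    have half: "(\<lambda>N. 1 / 2 ^ N :: real) \<longlonglongrightarrow> 0"
      using LIMSEQ_realpow_zero[of "1 / 2 :: real"] by (simp add: power_one_over)
    have "(\<lambda>N. h / 2 ^ N) \<longlonglongrightarrow> 0"
      using tendsto_mult_left[OF half, of h] by simp
    then have "filterlim (\<lambda>N. h / 2 ^ N) (at 0) sequentially"
      using h by (auto simp: filterlim_at)
    from filterlim_compose[OF lim this]
    have "(\<lambda>N. \<bar>\<phi> (h / 2 ^ N)\<bar> + e * \<bar>h\<bar> ^ m * (1 - 1 / 2 ^ N)) \<longlonglongrightarrow> \<bar>0\<bar> + e * \<bar>h\<bar> ^ m * (1 - 0)"
      by (intro tendsto_intros half)
    from LIMSEQ_le_const[OF this] iter show ?thesis by auto
  qed
  have "norm (\<phi> h / h ^ m - 0) < r" if "h \<noteq> 0" "norm (h - 0) < d" for h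
  proof -
    have "\<bar>\<phi> h / h ^ m\<bar> \<le> e"
      using bound[of h] that by (simp add: abs_divide power_abs divide_le_eq)
    with \<open>e < r\<close> show ?thesis by simp
  qed
  with \<open>0 < d\<close> show "\<exists>s>0. \<forall>x. x \<noteq> 0 \<and> norm (x - 0) < s \<longrightarrow> norm (\<phi> x / x ^ m - 0) < r"
    by blast
qed

text \<open>Dividing by h^k turns the hypothesis into an expansion of v(2h) - v(h) for v(h) = u(h) /
  h^k; subtracting a monomial from v removes its leading term, and
  \<open>tendsto_0_of_doubling\<close> applies.\<close>

lemma has_order_of_doubling:
  assumes "k < n" and lim: "((\<lambda>h. u h / h ^ k) \<longlongrightarrow> 0) (at 0)"
    and dbl: "has_order n (\<lambda>h. u (2 * h) - 2 ^ k * u h)"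
  shows "has_order n u"
proof -
  from dbl obtain C where C: "((\<lambda>h. (u (2 * h) - 2 ^ k * u h) / h ^ n) \<longlongrightarrow> C) (at 0)"
    by (auto simp: has_order_def)
  define m where "m = n - k"
  have m: "0 < m" "n = k + m" using \<open>k < n\<close> by (auto simp: m_def)
  \<comment> \<open>Chosen so that A (2h)^m - A h^m = (C / 2^k) h^m; the divisor is nonzero because
    \<open>k < n\<close>.\<close>
  define A where "A = C / 2 ^ k / (2 ^ m - 1)"
  have "(2::real) ^ m > 1" using m by simp
  then have A: "A * (2 ^ m - 1) = C / 2 ^ k" by (simp add: A_def)
  define \<phi> where "\<phi> h = u h / h ^ k - A * h ^ m" for h
  have "(\<phi> \<longlongrightarrow> 0 - A * 0 ^ m) (at 0)"
    unfolding \<phi>_def by (intro tendsto_intros lim)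
  with m(1) have 1: "(\<phi> \<longlongrightarrow> 0) (at 0)" by (simp add: zero_power)
  have "(\<phi> (2 * h) - \<phi> h) / h ^ m
      = (u (2 * h) - 2 ^ k * u h) / h ^ n / 2 ^ k - A * (2 ^ m - 1)" if "h \<noteq> 0" for h
    using that unfolding \<phi>_def m by (simp add: field_simps power_mult_distrib power_add)
  then have "eventually (\<lambda>h. (u (2 * h) - 2 ^ k * u h) / h ^ n / 2 ^ k - C / 2 ^ k
      = (\<phi> (2 * h) - \<phi> h) / h ^ m) (at 0)"
    unfolding A by (auto simp: eventually_at_filter)
  moreover have "((\<lambda>h. (u (2 * h) - 2 ^ k * u h) / h ^ n / 2 ^ k - C / 2 ^ k)
      \<longlongrightarrow> C / 2 ^ k - C / 2 ^ k) (at 0)"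
    by (intro tendsto_intros C) auto
  ultimately have "((\<lambda>h. (\<phi> (2 * h) - \<phi> h) / h ^ m) \<longlongrightarrow> 0) (at 0)"
    by (simp add: Lim_transform_eventually)
  from tendsto_0_of_doubling[OF m(1) 1 this]
  have "((\<lambda>h. \<phi> h / h ^ m + A) \<longlongrightarrow> 0 + A) (at 0)"
    by (intro tendsto_intros)
  moreover have "eventually (\<lambda>h. \<phi> h / h ^ m + A = u h / h ^ n) (at 0)"
    unfolding \<phi>_def m by (auto simp: eventually_at_filter field_simps power_add)
  ultimately have "((\<lambda>h. u h / h ^ n) \<longlongrightarrow> 0 + A) (at 0)"
    by (rule Lim_transform_eventually)
  then show ?thesis by (auto simp: has_order_def)
qed

text \<open>Handles g at all nodes x h; \<open>g 0 = 0\<close> covers the node x = 0, where the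
  dilation degenerates.\<close>

lemma tendsto_0_dilate:
  fixes g :: "real \<Rightarrow> real"
  assumes "g 0 = 0" "k \<le> m" and lim: "((\<lambda>h. g h / h ^ m) \<longlongrightarrow> 0) (at 0)"
  shows "((\<lambda>h. g (a * h) / h ^ k) \<longlongrightarrow> 0) (at 0)"
proof (cases "a = 0")
  case False
  have "filterlim (\<lambda>h. a * h) (at 0) (at 0)"
    using False by (auto simp: filterlim_at eventually_at_filter intro!: tendsto_eq_intros)
  from filterlim_compose[OF lim this]
  have "((\<lambda>h. g (a * h) / (a * h) ^ m * (a ^ m * h ^ (m - k))) \<longlongrightarrow> 0 * (a ^ m * 0 ^ (m - k))) (at 0)"
    by (intro tendsto_intros)
  moreover have "eventually (\<lambda>h. g (a * h) / (a * h) ^ m * (a ^ m * h ^ (m - k)) = g (a * h) / h ^ k) (at 0)"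
    using False \<open>k \<le> m\<close>
    by (auto simp: eventually_at_filter power_mult_distrib power_diff field_simps)
  ultimately show ?thesis
    by (simp add: Lim_transform_eventually)
qed (simp add: assms)

section \<open>Interpolating the remainder\<close>

lemma has_order_if_fdiff:
  fixes g :: "real \<Rightarrow> real"
  assumes "2 \<le> n" "g 0 = 0" and lim: "((\<lambda>h. g h / h ^ (n - 1)) \<longlongrightarrow> 0) (at 0)"
    and D: "\<And>s. s \<le> n - 2 \<Longrightarrow> has_order n (\<lambda>h. fdiff n (\<lambda>j. g (real (j + s) * h)))"
  shows "has_order n g"
proof -
  define P where "P h = interp n (\<lambda>x. g (real x * h))" for h
  define e where "e x h = g (real x * h) - poly (P h) (real x)" for x h
  have degP: "degree (P h) < n" for h
    using \<open>2 \<le> n\<close> by (auto simp: P_def intro: degree_interp)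
  \<comment> \<open>Shifting the argument by \<open>s\<close> keeps the degree of \<open>P h\<close>
    below \<open>n\<close>.\<close>
  have fdiff_e: "fdiff n (\<lambda>j. e (j + s) h) = fdiff n (\<lambda>j. g (real (j + s) * h))" for s h
  proof -
    have "degree (P h \<circ>\<^sub>p [:real s, 1:]) < n"
      using degP by (simp add: degree_pcompose)
    from fdiff_poly_eq_0[OF this]
    have "fdiff n (\<lambda>j. poly (P h) (real (j + s))) = 0"
      by (simp add: poly_pcompose add.commute)
    then show ?thesis by (simp add: e_def fdiff_diff)
  qed
  \<comment> \<open>The bound 2n - 2 is the largest doubled node 2(n - 1), and also n + s for the
    largest shift s = n - 2.\<close>
  have e: "has_order n (e x)" if "x \<le> 2 * n - 2" for x
    using that
  proof (induction x rule: less_induct)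
    case (less x)
    show ?case
    proof (cases "x < n")
      case True
      then have "e x = (\<lambda>h. 0)" by (auto simp: e_def P_def poly_interp)
      then show ?thesis by (simp add: has_order_0)
    next
      case False
      define s where "s = x - n"
      have s: "x = n + s" "s \<le> n - 2" using False less.prems by (auto simp: s_def)
      \<comment> \<open>The term j = n has coefficient 1, so the difference can be solved for
        \<open>e (n + s) h\<close>; the other terms have smaller indices.\<close>
      have "e x h = fdiff n (\<lambda>j. g (real (j + s) * h))
          - (\<Sum>j<n. ((-1) ^ (n - j) * real (n choose j)) * e (j + s) h)" for h
        unfolding fdiff_e[symmetric] s
        by (simp add: fdiff_def atLeast0AtMost flip: lessThan_Suc_atMost)
      then have "e x = (\<lambda>h. fdiff n (\<lambda>j. g (real (j + s) * h))
          - (\<Sum>j<n. ((-1) ^ (n - j) * real (n choose j)) * e (j + s) h))" by blast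
      moreover have "has_order n \<dots>"
        using s less.prems
        by (intro has_order_diff D has_order_sum has_order_cmult less.IH) auto
      ultimately show ?thesis by (simp only:)
    qed
  qed
  have coeff_order: "has_order n (\<lambda>h. coeff (P h) k)" if "k < n" for k
  proof (rule has_order_of_doubling[OF that])
    have "((\<lambda>h. \<Sum>x<n. g (real x * h) / h ^ k * coeff (lagrange n x) k) \<longlongrightarrow> (\<Sum>x<n. 0 * coeff (lagrange n x) k)) (at 0)"
      using \<open>k < n\<close> by (intro tendsto_intros tendsto_0_dilate[OF \<open>g 0 = 0\<close> _ lim]) auto
    then show "((\<lambda>h. coeff (P h) k / h ^ k) \<longlongrightarrow> 0) (at 0)"
      by (simp add: P_def coeff_interp sum_divide_distrib)
  next
    have "coeff (P (2 * h)) k - 2 ^ k * coeff (P h) k = (\<Sum>x<n. coeff (lagrange n x) k * e (2 * x) h)" for h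
    proof -
      \<comment> \<open>The k-th coefficients of \<open>P (2 * h)\<close> and of \<open>q\<close>
        are the same linear functional applied to g(2x h) and to P_h(2x), whose difference is
        \<open>e (2 * x) h\<close>.\<close>
      define q where "q = P h \<circ>\<^sub>p [:0, 2:]"
      have "degree q < n"
        using degP by (simp add: q_def degree_pcompose)
      then have "(\<Sum>x<n. poly q (real x) * coeff (lagrange n x) k) = coeff q k"
        by (simp add: interp_poly flip: coeff_interp)
      also have "\<dots> = 2 ^ k * coeff (P h) k"
        by (simp add: q_def coeff_pcompose_linear)
      finally have "(\<Sum>x<n. poly (P h) (real (2 * x)) * coeff (lagrange n x) k) = 2 ^ k * coeff (P h) k"
        by (simp add: q_def poly_pcompose mult.commute)
      moreover have "coeff (P (2 * h)) k = (\<Sum>x<n. g (real (2 * x) * h) * coeff (lagrange n x) k)"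
        by (simp add: P_def coeff_interp mult_ac)
      ultimately show ?thesis
        by (simp add: e_def right_diff_distrib sum_subtractf mult_ac)
    qed
    then show "has_order n (\<lambda>h. coeff (P (2 * h)) k - 2 ^ k * coeff (P h) k)"
      by (auto intro!: has_order_sum has_order_cmult e)
  qed
  have "g h = (\<Sum>k<n. coeff (P h) k)" for h
  proof -
    \<comment> \<open>As \<open>n\<close> \<ge> 2, the point 1 is a node.\<close>
    have "g h = poly (P h) (real 1)"
      using \<open>2 \<le> n\<close> by (subst P_def, subst poly_interp) auto
    also have "\<dots> = (\<Sum>k\<le>degree (P h). coeff (P h) k)"
      by (simp add: poly_altdef)
    also have "\<dots> = (\<Sum>k<n. coeff (P h) k)"
      using degP by (intro sum.mono_neutral_left) (auto simp: not_le intro: coeff_eq_0 le_less_trans)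
    finally show ?thesis .
  qed
  then have "g = (\<lambda>h. \<Sum>k<n. coeff (P h) k)" by blast
  with coeff_order show ?thesis by (auto intro: has_order_sum)
qed

section \<open>From the remainder back to f\<close>

theorem mainTheorem2:
  fixes n :: nat and c :: real and f :: "real \<Rightarrow> real"
  assumes "n \<ge> 2"
    and "peano_differentiable (n - 1) f c"
    and "\<forall>k::int. - (int n - 2) \<le> k \<and> k \<le> 0 \<longrightarrow>
           (\<exists>L::real. ((\<lambda>h::real. 1 / h ^ n *
              (\<Sum>j=0..n. (-1) ^ (n - j) * real (n choose j) * f (c + (real j - real_of_int k) * h)))
              \<longlongrightarrow> L) (at 0))"
  shows "peano_differentiable n f c"
proof -
  from assms(2) obtain p where p: "degree p \<le> n - 1" "poly p c = f c"
    and o: "(\<lambda>h. f (c + h) - poly p (c + h)) \<in> o[at 0](\<lambda>h. h ^ (n - 1))"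
    by (auto simp: peano_differentiable_def)
  define g where "g h = f (c + h) - poly p (c + h)" for h
  have "has_order n g"
  proof (rule has_order_if_fdiff[OF \<open>n \<ge> 2\<close>])
    show "g 0 = 0" by (simp add: g_def p)
    show "((\<lambda>h. g h / h ^ (n - 1)) \<longlongrightarrow> 0) (at 0)"
      using smalloD_tendsto[OF o] by (simp add: g_def)
    fix s assume s: "s \<le> n - 2"
    have "fdiff n (\<lambda>j. poly p (c + real (j + s) * h)) = 0" for h
    proof -
      \<comment> \<open>Only an inequality, since the inner polynomial is constant when h =
        0.\<close>
      have "degree (p \<circ>\<^sub>p [:c + real s * h, h:]) \<le> degree p * 1"
        by (rule order.trans[OF degree_pcompose_le]) (auto intro: mult_left_mono)
      also have "\<dots> < n" using p \<open>n \<ge> 2\<close> by simp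
      finally have "fdiff n (\<lambda>j. poly (p \<circ>\<^sub>p [:c + real s * h, h:]) (real j)) = 0"
        by (rule fdiff_poly_eq_0)
      then show ?thesis by (simp add: poly_pcompose algebra_simps)
    qed
    then have "fdiff n (\<lambda>j. g (real (j + s) * h)) / h ^ n
        = 1 / h ^ n * fdiff n (\<lambda>j. f (c + (real j - real_of_int (- int s)) * h))" for h
      by (simp add: g_def fdiff_diff)
    \<comment> \<open>The shift \<open>s\<close> corresponds to k = -s.\<close>
    moreover have "- (int n - 2) \<le> - int s \<and> - int s \<le> 0"
      using s \<open>n \<ge> 2\<close> by auto
    ultimately show "has_order n (\<lambda>h. fdiff n (\<lambda>j. g (real (j + s) * h)))"
      using assms(3) by (simp only: has_order_def) (simp only: fdiff_def)
  qed
  then obtain A where A: "((\<lambda>h. g h / h ^ n) \<longlongrightarrow> A) (at 0)"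
    by (auto simp: has_order_def)
  \<comment> \<open>The limit \<open>A\<close> supplies the missing coefficient of (x -
    c)^n.\<close>
  define q where "q = p + smult A ([:- c, 1:] ^ n)"
  have q: "poly q (c + h) = poly p (c + h) + A * h ^ n" for h
    by (simp add: q_def)
  have "degree ([:- c, 1:] ^ n) = n"
    by (simp add: degree_power_eq)
  then have "degree q \<le> n"
    unfolding q_def using p by (intro degree_add_le) (auto intro: order.trans[OF degree_smult_le])
  moreover have "poly q c = f c"
    using q[of 0] p \<open>n \<ge> 2\<close> by simp
  moreover have "(\<lambda>h. f (c + h) - poly q (c + h)) \<in> o[at 0](\<lambda>h. h ^ n)"
  proof (rule smalloI_tendsto)
    have "((\<lambda>h. g h / h ^ n - A) \<longlongrightarrow> A - A) (at 0)"
      by (intro tendsto_intros A)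
    moreover have "eventually (\<lambda>h. g h / h ^ n - A = (f (c + h) - poly q (c + h)) / h ^ n) (at 0)"
      by (auto simp: eventually_at_filter g_def q diff_divide_distrib add_divide_distrib)
    ultimately show "((\<lambda>h. (f (c + h) - poly q (c + h)) / h ^ n) \<longlongrightarrow> 0) (at 0)"
      by (simp add: Lim_transform_eventually)
  qed (simp only: eventually_at_filter, simp)
  ultimately show ?thesis
    unfolding peano_differentiable_def by blast
qed

end
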